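(* Let $[(M,\mathcal{E}_M),\phi,(G,\mathcal{E}_G,\ast)]$, $[(\tilde{M},\mathcal{E}_{\tilde{M}}),\tilde{\phi},(\tilde{G},\mathcal{E}_{\tilde{G}},\tilde{\ast})]$ and $[(\bar{M},\mathcal{E}_{\bar{M}}),\bar{\phi},(\bar{G},\mathcal{E}_{\bar{G}},\bar{\ast})]$ be coarse dynamical systems. Let $(f,h)$ be a coarse conjugate relation between $[(M,\mathcal{E}_M),\phi,(G,\mathcal{E}_G,\ast)]$ and $[(\tilde{M},\mathcal{E}_{\tilde{M}}),\tilde{\phi},(\tilde{G},\mathcal{E}_{\tilde{G}},\tilde{\ast})]$, and let $(k,l)$ be a coarse conjugate relation between $[(\tilde{M},\mathcal{E}_{\tilde{M}}),\tilde{\phi},(\tilde{G},\mathcal{E}_{\tilde{G}},\tilde{\ast})]$ and $[(\bar{M},\mathcal{E}_{\bar{M}}),\bar{\phi},(\bar{G},\mathcal{E}_{\bar{G}},\bar{\ast})]$. Then: (i) $(f^{-1},h^{-1})$ is a coarse conjugate relation between $[(\tilde{M},\mathcal{E}_{\tilde{M}}),\tilde{\phi},(\tilde{G},\mathcal{E}_{\tilde{G}},\tilde{\ast})]$ and $[(M,\mathcal{E}_M),\phi,(G,\mathcal{E}_G,\ast)]$; (ii) $(k\circ f,\, l\circ h)$ is a coarse conjugate relation between $[(M,\mathcal{E}_M),\phi,(G,\mathcal{E}_G,\ast)]$ and $[(\bar{M},\mathcal{E}_{\bar{M}}),\bar{\phi},(\bar{G},\mathcal{E}_{\bar{G}},\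bar{\ast})]$.
   Context: Coarse space: a pair $(M,\mathcal{E}_M)$ where $M$ is a set and $\mathcal{E}_M\subseteq P(M\times M)$ (a coarse structure, whose elements are called entourages) contains the diagonal $\{(m,m): m\in M\}$, is closed under taking subsets and under finite unions, and for all $E,F\in\mathcal{E}_M$ contains $E^{-1}=\{(m_2,m_1):(m_1,m_2)\in E\}$ and $E\circ F=\{(m_1,m_2)\in M\times M:\exists\, m_3\in M,\ (m_1,m_3)\in E,\ (m_3,m_2)\in F\}$. Asymorphism: a map $f:(M,\mathcal{E}_M)\to(N,\mathcal{E}_N)$ between coarse spaces is bornologous if $(f\times f)(E)\in\mathcal{E}_N$ for every $E\in\mathcal{E}_M$, where $(f\times f)(m_1,m_2)=(f(m_1),f(m_2))$. An asymorphism is a bijection $f$ such that both $f$ and $f^{-1}$ are bornologous. Coarse group: a triple $(G,\mathcal{E}_G,\ast)$ where $(G,\ast)$ is a group and $\mathcal{E}_G$ is a coarse structure on $G$ such that for every $E\in\mathcal{E}_G$ the set $\{(g\ast e_1,g\ast e_2): g\in G,\ (e_1,e_2)\in E\}$ belongs to $\mathcal{E}_G$. Coarse dynamical system (with coarse time): a triple $[(M,\mathcal{E}_M),\phi,(G,\mathcal{E}_G,\ast)]$ where $(M,\mathcal{E}_M)$ is a non-empty coarse space, $(G,\mathcal{E}_G,\ast)$ is a coarse group, and $\phi=(\phi^g)_{g\in G}$ is a family of asymorphisms $\phi^g:M\to M$ such that $\phi^{g_1}(\phi^{g_2}(m))=\phi^{g_1\ast g_2}(m)$ for all $g_1,g_2\in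 G$, $m\in M$, and $\phi^e=\mathrm{Id}_M$, where $e$ is the identity element of $G$. Coarse conjugate relation: a coarse conjugate relation $(f,h)$ between $[(M,\mathcal{E}_M),\phi,(G,\mathcal{E}_G,\ast)]$ and $[(\tilde{M},\mathcal{E}_{\tilde{M}}),\tilde{\phi},(\tilde{G},\mathcal{E}_{\tilde{G}},\tilde{\ast})]$ consists of an asymorphism $f:(M,\mathcal{E}_M)\to(\tilde{M},\mathcal{E}_{\tilde{M}})$ and an asymorphism $h:(G,\mathcal{E}_G)\to(\tilde{G},\mathcal{E}_{\tilde{G}})$ such that $h(g_1\ast g_2)=h(g_1)\,\tilde{\ast}\,h(g_2)$ for all $g_1,g_2\in G$, and $f\circ\phi^g=\tilde{\phi}^{h(g)}\circ f$ for all $g\in G$. *)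

theory Defs
  imports "HOL-Algebra.Group"
begin

text \<open>
  Spaces and groups live on explicit carrier sets, and maps between them are total HOL functions of
  which only the values on the carrier matter: equations between maps are stated pointwise on the
  carrier, and the inverse of a bijection with domain \<open>M\<close> is \<open>inv_into M f\<close>.
\<close>

locale coarse_space =
  fixes M :: "'m set" and \<E> :: "('m \<times> 'm) set set"
  assumes entourage_subset: "\<E> \<subseteq> Pow (M \<times> M)"
    and diagonal: "Id_on M \<in> \<E>"
    and subset_closed: "\<And>E F. E \<in> \<E> \<Longrightarrow> F \<subseteq> E \<Longrightarrow> F \<in> \<E>"
    and finite_Union_closed: "\<And>\<F>. finite \<F> \<Longrightarrow> \<F> \<subseteq> \<E> \<Longrightarrow> \<Union>\<F> \<in> \<E>"
    and converse_closed: "\<And>E. E \<in> \<E> \<Longrightarrow> E\<inverse> \<in> \<E>"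
    and relcomp_closed: "\<And>E F. E \<in> \<E> \<Longrightarrow> F \<in> \<E> \<Longrightarrow> E O F \<in> \<E>"

definition bornologous ::
    "'m set \<Rightarrow> ('m \<times> 'm) set set \<Rightarrow> 'n set \<Rightarrow> ('n \<times> 'n) set set \<Rightarrow> ('m \<Rightarrow> 'n) \<Rightarrow> bool"
  where "bornologous M \<E>M N \<E>N f \<longleftrightarrow>
    f \<in> M \<rightarrow> N \<and> (\<forall>E\<in>\<E>M. map_prod f f ` E \<in> \<E>N)"

definition asymorphism ::
    "'m set \<Rightarrow> ('m \<times> 'm) set set \<Rightarrow> 'n set \<Rightarrow> ('n \<times> 'n) set set \<Rightarrow> ('m \<Rightarrow> 'n) \<Rightarrow> bool"
  where "asymorphism M \<E>M N \<E>N f \<longleftrightarrow>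
    bij_betw f M N \<and> bornologous M \<E>M N \<E>N f \<and> bornologous N \<E>N M \<E>M (inv_into M f)"

locale coarse_group = group G + coarse_space "carrier G" \<E>
  for G :: "('g, 'b) monoid_scheme" (structure) and \<E> :: "('g \<times> 'g) set set" +
  assumes translate_closed:
    "\<And>E. E \<in> \<E> \<Longrightarrow> {(g \<otimes> e1, g \<otimes> e2) | g e1 e2. g \<in> carrier G \<and> (e1, e2) \<in> E} \<in> \<E>"

locale coarse_dynamical_system =
  phase: coarse_space M \<E>M + time: coarse_group G \<E>G
  for M :: "'m set" and \<E>M :: "('m \<times> 'm) set set"
    and \<phi> :: "'g \<Rightarrow> 'm \<Rightarrow> 'm"
    and G :: "('g, 'b) monoid_scheme" (structure) and \<E>G :: "('g \<times> 'g) set set" +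
  assumes nonempty: "M \<noteq> {}"
    and asymorphism_flow: "\<And>g. g \<in> carrier G \<Longrightarrow> asymorphism M \<E>M M \<E>M (\<phi> g)"
    and flow_mult: "\<And>g1 g2 m. g1 \<in> carrier G \<Longrightarrow> g2 \<in> carrier G \<Longrightarrow> m \<in> M \<Longrightarrow>
                      \<phi> g1 (\<phi> g2 m) = \<phi> (g1 \<otimes> g2) m"
    and flow_one: "\<And>m. m \<in> M \<Longrightarrow> \<phi> \<one> m = m"

definition coarse_conjugate_relation ::
    "'m set \<Rightarrow> ('m \<times> 'm) set set \<Rightarrow> ('g \<Rightarrow> 'm \<Rightarrow> 'm) \<Rightarrow> ('g, 'b) monoid_scheme \<Rightarrow> ('g \<times> 'g) set set \<Rightarrow>
     'n set \<Rightarrow> ('n \<times> 'n) set set \<Rightarrow> ('h \<Rightarrow> 'n \<Rightarrow> 'n) \<Rightarrow> ('h, 'c) monoid_scheme \<Rightarrow> ('h \<times> 'h) set set \<Rightarrow>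
     ('m \<Rightarrow> 'n) \<Rightarrow> ('g \<Rightarrow> 'h) \<Rightarrow> bool"
  where "coarse_conjugate_relation M \<E>M \<phi> G \<E>G N \<E>N \<psi> H \<E>H f h \<longleftrightarrow>
    asymorphism M \<E>M N \<E>N f \<and>
    asymorphism (carrier G) \<E>G (carrier H) \<E>H h \<and>
    h \<in> hom G H \<and>
    (\<forall>g\<in>carrier G. \<forall>m\<in>M. f (\<phi> g m) = \<psi> (h g) (f m))"

end

theory Submission
  imports Defs
begin

text \<open>
  Asymorphisms are the isomorphisms of coarse spaces and a conjugacy is an isomorphism of actions, so
  both parts say that isomorphisms form a groupoid. The algebra is routine: the inverse of a bijective
  homomorphism is one, and an intertwining square can be reversed along bijections or pasted to
  another one.

  The coarse part needs some care because maps matter only on carriers. The second inverse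
  \<open>inv_into N (inv_into M f)\<close> and the inverse of a composite coincide with \<open>f\<close>
  and with the composite of the inverses only there, not as functions on the whole type.
  Entourages are relations on the carrier, so being bornologous cannot detect the
  difference (\<open>bornologous_cong\<close>); this makes asymorphisms closed under inverses and
  composition.
\<close>

lemma bornologous_cong:
  assumes "\<E>M \<subseteq> Pow (M \<times> M)"
    and eq: "\<And>x. x \<in> M \<Longrightarrow> f x = g x"
    and f: "bornologous M \<E>M N \<E>N f"
  shows "bornologous M \<E>M N \<E>N g"
proof -
  have "map_prod f f ` E = map_prod g g ` E" if "E \<in> \<E>M" for E
  proof (intro image_cong refl)
    fix p assume "p \<in> E"
    then have "p \<in> M \<times> M"
      using assms(1) that by blast
    then show "map_prod f f p = map_prod g g p"
      using eq by auto
  qed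
  moreover have "g \<in> M \<rightarrow> N"
    using f eq by (auto simp: bornologous_def Pi_iff)
  ultimately show ?thesis
    using f by (auto simp: bornologous_def)
qed

lemma bornologous_comp:
  assumes "bornologous M \<E>M N \<E>N f" and "bornologous N \<E>N P \<E>P g"
  shows "bornologous M \<E>M P \<E>P (g \<circ> f)"
proof -
  have "map_prod (g \<circ> f) (g \<circ> f) ` E = map_prod g g ` map_prod f f ` E" for E
    by (simp add: map_prod.comp[symmetric] image_comp)
  then show ?thesis
    using assms by (auto simp: bornologous_def Pi_iff)
qed

lemma asymorphism_inv_into:
  assumes "\<E>M \<subseteq> Pow (M \<times> M)" and f: "asymorphism M \<E>M N \<E>N f"
  shows "asymorphism N \<E>N M \<E>M (inv_into M f)"
proof -
  have bij: "bij_betw f M N"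
    using f by (simp add: asymorphism_def)
  have "bornologous M \<E>M N \<E>N (inv_into N (inv_into M f))"
  proof (rule bornologous_cong[OF assms(1)])
    show "f x = inv_into N (inv_into M f) x" if "x \<in> M" for x
      using inv_into_inv_into_eq[OF bij that] by simp
    show "bornologous M \<E>M N \<E>N f"
      using f by (simp add: asymorphism_def)
  qed
  then show ?thesis
    using f by (auto simp: asymorphism_def bij_betw_inv_into)
qed

lemma asymorphism_comp:
  assumes "\<E>P \<subseteq> Pow (P \<times> P)"
    and f: "asymorphism M \<E>M N \<E>N f" and g: "asymorphism N \<E>N P \<E>P g"
  shows "asymorphism M \<E>M P \<E>P (g \<circ> f)"
proof -
  have bij: "bij_betw f M N" "bij_betw g N P"
    using f g by (simp_all add: asymorphism_def)
  have "(inv_into M f \<circ> inv_into N g) x = inv_into M (g \<circ> f) x" if "x \<in> P" for x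
    using inv_into_comp[of g f M x] bij that by (auto simp: bij_betw_def)
  moreover have "bornologous P \<E>P M \<E>M (inv_into M f \<circ> inv_into N g)"
    using f g bornologous_comp by (auto simp: asymorphism_def)
  ultimately have "bornologous P \<E>P M \<E>M (inv_into M (g \<circ> f))"
    using bornologous_cong[OF assms(1)] by blast
  moreover have "bornologous M \<E>M P \<E>P (g \<circ> f)"
    using f g bornologous_comp by (auto simp: asymorphism_def)
  ultimately show ?thesis
    using bij_betw_trans[OF bij] by (simp add: asymorphism_def)
qed

text \<open>
  A time \<open>a\<close> and a point \<open>n\<close> of the target are the images under \<open>h\<close> and \<open>f\<close> of a unique time \<open>g\<close> and
  point \<open>m\<close>, so by equivariance \<open>f\<inverse> (\<psi> a n)\<close> is \<open>f\<inverse> (f (\<phi> g m))\<close>. To cancel \<open>f\<close> here,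
  the flow must keep \<open>m\<close> in \<open>M\<close>; this, and the group laws behind the inverse of a
  homomorphism, come from the dynamical system on the source side.
\<close>

lemma coarse_conjugate_relation_inv_into:
  assumes sys: "coarse_dynamical_system M \<E>M \<phi> G \<E>G"
    and rel: "coarse_conjugate_relation M \<E>M \<phi> G \<E>G N \<E>N \<psi> H \<E>H f h"
  shows "coarse_conjugate_relation N \<E>N \<psi> H \<E>H M \<E>M \<phi> G \<E>G
           (inv_into M f) (inv_into (carrier G) h)"
proof -
  interpret coarse_dynamical_system M \<E>M \<phi> G \<E>G by (fact sys)
  have f: "asymorphism M \<E>M N \<E>N f"
    and h: "asymorphism (carrier G) \<E>G (carrier H) \<E>H h"
    and hom: "h \<in> hom G H"
    and comm: "\<And>g m. g \<in> carrier G \<Longrightarrow> m \<in> M \<Longrightarrow> f (\<phi> g m) = \<psi> (h g) (f m)"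
    using rel by (auto simp: coarse_conjugate_relation_def)
  have bij_f: "bij_betw f M N" and bij_h: "bij_betw h (carrier G) (carrier H)"
    using f h by (simp_all add: asymorphism_def)
  have "inv_into (carrier G) h \<in> hom H G"
    using time.iso_set_sym[of h H] hom bij_h by (simp add: iso_def)
  moreover have "inv_into M f (\<psi> a n) = \<phi> (inv_into (carrier G) h a) (inv_into M f n)"
    if "a \<in> carrier H" "n \<in> N" for a n
  proof -
    define g where "g = inv_into (carrier G) h a"
    define m where "m = inv_into M f n"
    have g: "g \<in> carrier G" "h g = a"
      using bij_h that(1) unfolding g_def by (auto simp: bij_betw_def inv_into_into f_inv_into_f)
    have m: "m \<in> M" "f m = n"
      using bij_f that(2) unfolding m_def by (auto simp: bij_betw_def inv_into_into f_inv_into_f)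
    have "\<phi> g m \<in> M"
      using asymorphism_flow[OF g(1)] m(1) by (auto simp: asymorphism_def bij_betw_def)
    then have "inv_into M f (f (\<phi> g m)) = \<phi> g m"
      using bij_f by (simp add: bij_betw_def)
    then show ?thesis
      using comm[OF g(1) m(1)] g(2) m(2) by (simp add: g_def m_def)
  qed
  ultimately show ?thesis
    using asymorphism_inv_into[OF phase.entourage_subset f]
      asymorphism_inv_into[OF time.entourage_subset h]
    by (simp add: coarse_conjugate_relation_def)
qed

lemma coarse_conjugate_relation_comp:
  assumes sys: "coarse_dynamical_system P \<E>P \<chi> K \<E>K"
    and fh: "coarse_conjugate_relation M \<E>M \<phi> G \<E>G N \<E>N \<psi> H \<E>H f h"
    and kl: "coarse_conjugate_relation N \<E>N \<psi> H \<E>H P \<E>P \<chi> K \<E>K k l"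
  shows "coarse_conjugate_relation M \<E>M \<phi> G \<E>G P \<E>P \<chi> K \<E>K (k \<circ> f) (l \<circ> h)"
proof -
  interpret coarse_dynamical_system P \<E>P \<chi> K \<E>K by (fact sys)
  have "asymorphism M \<E>M P \<E>P (k \<circ> f)"
    and "asymorphism (carrier G) \<E>G (carrier K) \<E>K (l \<circ> h)"
    using fh kl asymorphism_comp[OF phase.entourage_subset] asymorphism_comp[OF time.entourage_subset]
    by (auto simp: coarse_conjugate_relation_def)
  moreover have "l \<circ> h \<in> hom G K"
    using fh kl by (auto simp: coarse_conjugate_relation_def hom_def Pi_iff)
  moreover have "f \<in> M \<rightarrow> N" "h \<in> carrier G \<rightarrow> carrier H"
    using fh by (auto simp: coarse_conjugate_relation_def asymorphism_def bornologous_def)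
  then have "\<forall>g\<in>carrier G. \<forall>m\<in>M. (k \<circ> f) (\<phi> g m) = \<chi> ((l \<circ> h) g) ((k \<circ> f) m)"
    using fh kl by (auto simp: coarse_conjugate_relation_def Pi_iff)
  ultimately show ?thesis
    by (simp add: coarse_conjugate_relation_def)
qed

theorem theorem3p4:
  fixes M :: "'m set" and \<E>M :: "('m \<times> 'm) set set"
    and \<phi> :: "'g \<Rightarrow> 'm \<Rightarrow> 'm"
    and G :: "('g, 'b) monoid_scheme" and \<E>G :: "('g \<times> 'g) set set"
    and M' :: "'m1 set" and \<E>M' :: "('m1 \<times> 'm1) set set"
    and \<phi>' :: "'g1 \<Rightarrow> 'm1 \<Rightarrow> 'm1"
    and G' :: "('g1, 'b1) monoid_scheme" and \<E>G' :: "('g1 \<times> 'g1) set set"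
    and M'' :: "'m2 set" and \<E>M'' :: "('m2 \<times> 'm2) set set"
    and \<phi>'' :: "'g2 \<Rightarrow> 'm2 \<Rightarrow> 'm2"
    and G'' :: "('g2, 'b2) monoid_scheme" and \<E>G'' :: "('g2 \<times> 'g2) set set"
    and f :: "'m \<Rightarrow> 'm1" and h :: "'g \<Rightarrow> 'g1"
    and k :: "'m1 \<Rightarrow> 'm2" and l :: "'g1 \<Rightarrow> 'g2"
  assumes "coarse_dynamical_system M \<E>M \<phi> G \<E>G"
    and "coarse_dynamical_system M' \<E>M' \<phi>' G' \<E>G'"
    and "coarse_dynamical_system M'' \<E>M'' \<phi>'' G'' \<E>G''"
    and "coarse_conjugate_relation M \<E>M \<phi> G \<E>G M' \<E>M' \<phi>' G' \<E>G' f h"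
    and "coarse_conjugate_relation M' \<E>M' \<phi>' G' \<E>G' M'' \<E>M'' \<phi>'' G'' \<E>G'' k l"
  shows "coarse_conjugate_relation M' \<E>M' \<phi>' G' \<E>G' M \<E>M \<phi> G \<E>G
           (inv_into M f) (inv_into (carrier G) h)
       \<and> coarse_conjugate_relation M \<E>M \<phi> G \<E>G M'' \<E>M'' \<phi>'' G'' \<E>G'' (k \<circ> f) (l \<circ> h)"
  using coarse_conjugate_relation_inv_into[OF assms(1,4)]
    coarse_conjugate_relation_comp[OF assms(3-5)]
  by blast

end
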